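(* Let $n,m\ge 2$, let $q\in\mathbb{K}$ be a primitive $n$th root of unity, $p\in\mathbb{K}$ with $p^2=q$, and $0\le a,b<n$. If $a\not\equiv b\pmod n$, then $V_{a,b}$ is a simple left $H_{n,m}$-module.
   Context: $\mathbb{K}$ is a field of characteristic zero. $H_{n,m}$ is the Hopf algebra of dimension $n^mm!$ generated as an algebra by $x_1,\dots,x_m,z_1,\dots,z_{m-1}$ with defining relations $x_i^n=1$, $x_ix_j=x_jx_i$, $z_kx_i=x_{s_k(i)}z_k$ where $s_k=(k,k+1)$, $z_kz_l=z_lz_k$ for $|k-l|>1$, $z_kz_{k+1}z_k=z_{k+1}z_kz_{k+1}$, $z_k^2=\frac1n\sum_{i,j=0}^{n-1}q^{-ij}x_k^ix_{k+1}^j$; the $x_i$ are group-like, $\Delta(z_k)=\big(\frac1n\sum_{i,j=0}^{n-1}q^{-ij}x_k^i\otimes x_{k+1}^j\big)(z_k\otimes z_k)$, $\epsilon(z_k)=1$, $S(z_k)=z_k$. $V_{a,b}$ is the left $H_{n,m}$-module with $\mathbb{K}$-basis $u_1,\dots,u_m$ and action $x_i\cdot u_i=q^au_i$, $x_i\cdot u_j=q^bu_j$ for $j\ne i$, and $z_k\cdot u_k=q^{ab}u_{k+1}$, $z_k\cdot u_{k+1}=u_k$, $z_k\cdot u_j=p^{b^2}u_j$ for $j\notin\{k,k+1\}$. *)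

theory Defs
  imports
    Complex_Main
    "HOL-Algebra.Module"
    "HOL-Algebra.QuotRing"
    "HOL-Combinatorics.Transposition"
    "HOL-Library.Poly_Mapping"
    "HOL-Number_Theory.Cong"
begin

section \<open>Simple left modules over a ring\<close>

text \<open>The library locale \<^locale>\<open>module\<close> requires a commutative base ring; the following is the
  same list of axioms over an arbitrary ring. The library locale \<^locale>\<open>submodule\<close> imposes
  nothing on the base ring, so it is used as it is.\<close>

locale left_module = R?: ring R + M?: abelian_group M
  for R (structure) and M :: "('a, 'b, 'c) module_scheme" (structure) +
  assumes smult_closed:
      "\<lbrakk>r \<in> carrier R; v \<in> carrier M\<rbrakk> \<Longrightarrow> r \<odot>\<^bsub>M\<^esub> v \<in> carrier M"
    and smult_l_distr:
      "\<lbrakk>r \<in> carrier R; s \<in> carrier R; v \<in> carrier M\<rbrakk> \<Longrightarrow>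
        (r \<oplus>\<^bsub>R\<^esub> s) \<odot>\<^bsub>M\<^esub> v = r \<odot>\<^bsub>M\<^esub> v \<oplus>\<^bsub>M\<^esub> s \<odot>\<^bsub>M\<^esub> v"
    and smult_r_distr:
      "\<lbrakk>r \<in> carrier R; v \<in> carrier M; w \<in> carrier M\<rbrakk> \<Longrightarrow>
        r \<odot>\<^bsub>M\<^esub> (v \<oplus>\<^bsub>M\<^esub> w) = r \<odot>\<^bsub>M\<^esub> v \<oplus>\<^bsub>M\<^esub> r \<odot>\<^bsub>M\<^esub> w"
    and smult_assoc:
      "\<lbrakk>r \<in> carrier R; s \<in> carrier R; v \<in> carrier M\<rbrakk> \<Longrightarrow>
        (r \<otimes>\<^bsub>R\<^esub> s) \<odot>\<^bsub>M\<^esub> v = r \<odot>\<^bsub>M\<^esub> (s \<odot>\<^bsub>M\<^esub> v)"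
    and smult_one:
      "v \<in> carrier M \<Longrightarrow> \<one>\<^bsub>R\<^esub> \<odot>\<^bsub>M\<^esub> v = v"

locale simple_left_module = left_module +
  assumes nontrivial: "carrier M \<noteq> {\<zero>\<^bsub>M\<^esub>}"
    and only_trivial_submodules:
      "submodule N R M \<Longrightarrow> N = {\<zero>\<^bsub>M\<^esub>} \<or> N = carrier M"


section \<open>Free associative algebras\<close>

datatype 'g free_mon = Word (letters: "'g list")

text \<open>The free monoid is written additively, so that the convolution product on
  \<^typ>\<open>'g free_mon \<Rightarrow>\<^sub>0 'k\<close> is the (noncommutative) product of the free algebra.\<close>

instantiation free_mon :: (type) monoid_add
begin

definition zero_free_mon :: "'a free_mon" where
  "zero_free_mon = Word []"

definition plus_free_mon :: "'a free_mon \<Rightarrow> 'a free_mon \<Rightarrow> 'a free_mon" where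
  "plus_free_mon v w = Word (letters v @ letters w)"

instance
  by standard (simp_all add: zero_free_mon_def plus_free_mon_def)

end

definition free_algebra :: "'g set \<Rightarrow> ('g free_mon \<Rightarrow>\<^sub>0 'k::field) ring" where
  "free_algebra G =
    \<lparr>carrier = {f. \<forall>w \<in> Poly_Mapping.keys f. set (letters w) \<subseteq> G},
     monoid.mult = (*), one = 1, zero = 0, add = (+)\<rparr>"

definition gen :: "'g \<Rightarrow> 'g free_mon \<Rightarrow>\<^sub>0 'k::field" where
  "gen g = Poly_Mapping.single (Word [g]) 1"

definition scalar :: "'k::field \<Rightarrow> 'g free_mon \<Rightarrow>\<^sub>0 'k" where
  "scalar c = Poly_Mapping.single 0 c"


section \<open>The algebra $H_{n,m}$\<close>

definition primitive_root :: "nat \<Rightarrow> 'k::field \<Rightarrow> bool" where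
  "primitive_root n q \<longleftrightarrow> n > 0 \<and> q ^ n = 1 \<and> (\<forall>k. 0 < k \<and> k < n \<longrightarrow> q ^ k \<noteq> 1)"

datatype generator = GX nat | GZ nat

definition H_gens :: "nat \<Rightarrow> generator set" where
  "H_gens m = GX ` {1..m} \<union> GZ ` {1..<m}"

abbreviation xx :: "nat \<Rightarrow> generator free_mon \<Rightarrow>\<^sub>0 'k::field" where
  "xx i \<equiv> gen (GX i)"

abbreviation zz :: "nat \<Rightarrow> generator free_mon \<Rightarrow>\<^sub>0 'k::field" where
  "zz k \<equiv> gen (GZ k)"

text \<open>A defining relation $l = r$ is represented by the element $l - r$ of the free algebra.\<close>

definition H_rels :: "nat \<Rightarrow> nat \<Rightarrow> 'k::field \<Rightarrow> (generator free_mon \<Rightarrow>\<^sub>0 'k) set" where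
  "H_rels n m q =
     {xx i ^ n - 1 | i. i \<in> {1..m}}
   \<union> {xx i * xx j - xx j * xx i | i j. i \<in> {1..m} \<and> j \<in> {1..m}}
   \<union> {zz k * xx i - xx (transpose k (k + 1) i) * zz k | k i. k \<in> {1..<m} \<and> i \<in> {1..m}}
   \<union> {zz k * zz l - zz l * zz k | k l.
        k \<in> {1..<m} \<and> l \<in> {1..<m} \<and> \<bar>int k - int l\<bar> > 1}
   \<union> {zz k * zz (k + 1) * zz k - zz (k + 1) * zz k * zz (k + 1) | k.
        k \<in> {1..<m} \<and> k + 1 \<in> {1..<m}}
   \<union> {zz k ^ 2 - scalar (1 / of_nat n) *
          (\<Sum>i = 0..n - 1. \<Sum>j = 0..n - 1.
             scalar (q powi - (int i * int j)) * xx k ^ i * xx (k + 1) ^ j) | k.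
        k \<in> {1..<m}}"

definition H_algebra ::
    "nat \<Rightarrow> nat \<Rightarrow> 'k::field \<Rightarrow> (generator free_mon \<Rightarrow>\<^sub>0 'k) set ring" where
  "H_algebra n m q =
     free_algebra (H_gens m) Quot (Idl\<^bsub>free_algebra (H_gens m)\<^esub> (H_rels n m q))"


section \<open>The module $V_{a,b}$\<close>

text \<open>Vectors are coordinate functions with respect to the basis $u_1, \dots, u_m$, supported on
  the indices $1, \dots, m$.\<close>

definition basis_vec :: "nat \<Rightarrow> nat \<Rightarrow> 'k::field" where
  "basis_vec j = (\<lambda>l. if l = j then 1 else 0)"

fun act_basis :: "'k::field \<Rightarrow> 'k \<Rightarrow> nat \<Rightarrow> nat \<Rightarrow> generator \<Rightarrow> nat \<Rightarrow> nat \<Rightarrow> 'k" where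
  "act_basis q p a b (GX i) j =
     (if j = i then (\<lambda>l. q ^ a * basis_vec j l) else (\<lambda>l. q ^ b * basis_vec j l))"
| "act_basis q p a b (GZ k) j =
     (if j = k then (\<lambda>l. q ^ (a * b) * basis_vec (k + 1) l)
      else if j = k + 1 then basis_vec k
      else (\<lambda>l. p ^ (b ^ 2) * basis_vec j l))"

definition act_gen ::
    "nat \<Rightarrow> 'k::field \<Rightarrow> 'k \<Rightarrow> nat \<Rightarrow> nat \<Rightarrow> generator \<Rightarrow> (nat \<Rightarrow> 'k) \<Rightarrow> nat \<Rightarrow> 'k" where
  "act_gen m q p a b g v = (\<lambda>l. \<Sum>j = 1..m. v j * act_basis q p a b g j l)"

definition act_free ::
    "nat \<Rightarrow> 'k::field \<Rightarrow> 'k \<Rightarrow> nat \<Rightarrow> nat \<Rightarrow>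
      (generator free_mon \<Rightarrow>\<^sub>0 'k) \<Rightarrow> (nat \<Rightarrow> 'k) \<Rightarrow> nat \<Rightarrow> 'k" where
  "act_free m q p a b f v =
     (\<lambda>l. \<Sum>w \<in> Poly_Mapping.keys f.
        Poly_Mapping.lookup f w * foldr (act_gen m q p a b) (letters w) v l)"

text \<open>An element of \<^const>\<open>H_algebra\<close> is a coset \<open>C\<close>, acting through any of its representatives.
  The representatives act equally exactly because the defining relations act as zero. This is part
  of what has to be shown for \<open>V_module\<close> to satisfy the axioms of \<^locale>\<open>left_module\<close>; it is not
  built into the definition. The ring fields \<open>mult\<close> and \<open>one\<close> of a module record are irrelevant.\<close>

definition V_module ::
    "nat \<Rightarrow> 'k::field \<Rightarrow> 'k \<Rightarrow> nat \<Rightarrow> nat \<Rightarrow>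
      ((generator free_mon \<Rightarrow>\<^sub>0 'k) set, nat \<Rightarrow> 'k) module" where
  "V_module m q p a b =
    \<lparr>carrier = {v. \<forall>l. l \<notin> {1..m} \<longrightarrow> v l = 0},
     monoid.mult = undefined, one = undefined,
     zero = (\<lambda>_. 0), add = (\<lambda>v w l. v l + w l),
     smult = (\<lambda>C v. the_elem ((\<lambda>f. act_free m q p a b f v) ` C))\<rparr>"

end

theory Submission
  imports Defs
begin

text \<open>Checking the defining relations coordinatewise gives an action of $H_{n,m}$ on $V_{a,b}$. For
  simplicity, the element $x_i - q^b$ sends a vector $v$ to $(q^a - q^b) v_i u_i$, and
  $q^a \neq q^b$. So a submodule with a nonzero vector contains some $u_i$, and the $z_k$ then move
  it to every other basis vector up to nonzero scalars.\<close>

section \<open>Modules over a quotient ring\<close>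

text \<open>Because \<open>I\<close> annihilates \<open>M\<close>, all representatives of a coset
  act alike, so the set of their values is a singleton and \<open>the_elem\<close> reads it off. The
  second conclusion lets later arguments compute with representatives only.\<close>

lemma left_module_Quot:
  fixes R (structure) and M (structure)
  assumes "left_module R M" and "ideal I R"
    and annihilates: "\<And>r v. \<lbrakk>r \<in> I; v \<in> carrier M\<rbrakk> \<Longrightarrow> r \<odot>\<^bsub>M\<^esub> v = \<zero>\<^bsub>M\<^esub>"
    and smult_coset: "\<And>r v. \<lbrakk>r \<in> carrier R; v \<in> carrier M\<rbrakk> \<Longrightarrow>
      smult N (I +>\<^bsub>R\<^esub> r) v = the_elem ((\<lambda>s. s \<odot>\<^bsub>M\<^esub> v) ` (I +>\<^bsub>R\<^esub> r))"
    and N: "carrier N = carrier M" "add N = add M" "zero N = zero M"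
  shows "left_module (R Quot I) N"
    and "\<And>r v. \<lbrakk>r \<in> carrier R; v \<in> carrier M\<rbrakk> \<Longrightarrow> smult N (I +>\<^bsub>R\<^esub> r) v = r \<odot>\<^bsub>M\<^esub> v"
proof -
  interpret left_module R M by fact
  interpret ideal I R by fact
  show act: "smult N (I +>\<^bsub>R\<^esub> r) v = r \<odot>\<^bsub>M\<^esub> v" if r: "r \<in> carrier R" and v: "v \<in> carrier M" for r v
  proof -
    have "s \<odot>\<^bsub>M\<^esub> v = r \<odot>\<^bsub>M\<^esub> v" if s: "s \<in> I +>\<^bsub>R\<^esub> r" for s
    proof -
      obtain h where h: "h \<in> I" "s = h \<oplus>\<^bsub>R\<^esub> r"
        using s by (auto simp: a_r_coset_def')
      have "h \<in> carrier R"
        using h(1) a_subset by blast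
      with h r v show ?thesis
        by (simp add: smult_l_distr annihilates smult_closed)
    qed
    then have "(\<lambda>s. s \<odot>\<^bsub>M\<^esub> v) ` (I +>\<^bsub>R\<^esub> r) = (\<lambda>_. r \<odot>\<^bsub>M\<^esub> v) ` (I +>\<^bsub>R\<^esub> r)"
      by (rule image_cong[OF refl])
    \<comment> \<open>The coset is nonempty, as it contains \<open>r\<close>; otherwise the image
      would be empty and \<open>the_elem\<close> meaningless.\<close>
    also have "\<dots> = {r \<odot>\<^bsub>M\<^esub> v}"
      using a_rcos_self[OF r] by (rule image_constant)
    finally have "(\<lambda>s. s \<odot>\<^bsub>M\<^esub> v) ` (I +>\<^bsub>R\<^esub> r) = {r \<odot>\<^bsub>M\<^esub> v}" .
    then show ?thesis
      using r v by (simp add: smult_coset)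
  qed
  interpret Q: ring "R Quot I"
    by (rule quotient_is_ring)
  have gr: "abelian_group N"
    by (rule abelian_groupI)
      (auto simp: N M.a_ac intro: M.l_neg M.a_inv_closed)
  have carr: "\<exists>r \<in> carrier R. C = I +>\<^bsub>R\<^esub> r" if "C \<in> carrier (R Quot I)" for C
    using that by (auto simp: FactRing_simps)
  show "left_module (R Quot I) N"
  proof (intro left_module.intro Q.ring_axioms gr left_module_axioms.intro)
    fix C v assume "C \<in> carrier (R Quot I)" "v \<in> carrier N"
    then show "smult N C v \<in> carrier N"
      by (auto simp: N act smult_closed dest!: carr)
  next
    fix C D v assume CD: "C \<in> carrier (R Quot I)" "D \<in> carrier (R Quot I)" "v \<in> carrier N"
    then obtain r s where rs: "r \<in> carrier R" "C = I +>\<^bsub>R\<^esub> r" "s \<in> carrier R" "D = I +>\<^bsub>R\<^esub> s"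
      using carr by meson
    have "C \<oplus>\<^bsub>R Quot I\<^esub> D = I +>\<^bsub>R\<^esub> (r \<oplus>\<^bsub>R\<^esub> s)"
      using rs by (simp add: FactRing_def a_rcos_sum)
    then show "smult N (C \<oplus>\<^bsub>R Quot I\<^esub> D) v = smult N C v \<oplus>\<^bsub>N\<^esub> smult N D v"
      using rs CD by (simp add: N act smult_l_distr)
    have "C \<otimes>\<^bsub>R Quot I\<^esub> D = I +>\<^bsub>R\<^esub> (r \<otimes>\<^bsub>R\<^esub> s)"
      using rs by (simp add: FactRing_def rcoset_mult_add)
    then show "smult N (C \<otimes>\<^bsub>R Quot I\<^esub> D) v = smult N C (smult N D v)"
      using rs CD by (simp add: N act smult_assoc smult_closed)
  next
    fix C v w assume "C \<in> carrier (R Quot I)" "v \<in> carrier N" "w \<in> carrier N"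
    then show "smult N C (v \<oplus>\<^bsub>N\<^esub> w) = smult N C v \<oplus>\<^bsub>N\<^esub> smult N C w"
      by (auto simp: N act smult_r_distr dest!: carr)
  next
    fix v assume "v \<in> carrier N"
    then show "smult N \<one>\<^bsub>R Quot I\<^esub> v = v"
      by (simp add: FactRing_def N act smult_one)
  qed
qed


section \<open>Free algebras\<close>

text \<open>Reduces additive statements about the free algebra to monomials. Adjoining a fresh key
  to the support is the same as adding a monomial.\<close>

lemma poly_mapping_single_add_induct [case_names zero single add]:
  assumes "P 0" and "\<And>w c. P (Poly_Mapping.single w c)"
    and "\<And>f g. P f \<Longrightarrow> P g \<Longrightarrow> P (f + g)"
  shows "P (f :: 'a \<Rightarrow>\<^sub>0 'b::monoid_add)"
proof (induction f rule: update_induct)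
  case const
  show ?case by (fact assms(1))
next
  case (update f a b)
  have "Poly_Mapping.update a b f = Poly_Mapping.single a b + f"
    using update(1)
    by (intro poly_mapping_eqI) (auto simp: lookup_update lookup_add lookup_single when_def in_keys_iff)
  then show ?case
    using assms(2,3) update(3) by simp
qed

context
  fixes G :: "'g set"
begin

lemma carrier_free_algebra:
  "carrier (free_algebra G) = {f. \<forall>w \<in> Poly_Mapping.keys f. set (letters w) \<subseteq> G}"
  by (simp add: free_algebra_def)

lemma add_carrier_free_algebra:
  assumes "f \<in> carrier (free_algebra G)" "g \<in> carrier (free_algebra G)"
  shows "f + g \<in> carrier (free_algebra G)"
  using assms keys_add[of f g] unfolding carrier_free_algebra by blast

lemma uminus_carrier_free_algebra:
  "f \<in> carrier (free_algebra G) \<Longrightarrow> - f \<in> carrier (free_algebra G)"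
  unfolding carrier_free_algebra by (simp add: in_keys_iff)

lemma diff_carrier_free_algebra:
  assumes "f \<in> carrier (free_algebra G)" "g \<in> carrier (free_algebra G)"
  shows "f - g \<in> carrier (free_algebra G)"
  using add_carrier_free_algebra[OF assms(1) uminus_carrier_free_algebra[OF assms(2)]] by simp

lemma mult_carrier_free_algebra:
  assumes "f \<in> carrier (free_algebra G)" "g \<in> carrier (free_algebra G)"
  shows "f * g \<in> carrier (free_algebra G)"
proof -
  have "set (letters w) \<subseteq> G" if w: "w \<in> Poly_Mapping.keys (f * g)" for w
  proof -
    obtain u v where "w = u + v" "u \<in> Poly_Mapping.keys f" "v \<in> Poly_Mapping.keys g"
      using keys_mult[of f g] w by blast
    with assms show ?thesis
      by (simp add: carrier_free_algebra plus_free_mon_def)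
  qed
  then show ?thesis by (simp add: carrier_free_algebra)
qed

lemma scalar_carrier_free_algebra: "scalar c \<in> carrier (free_algebra G)"
  by (simp add: carrier_free_algebra scalar_def zero_free_mon_def)

lemma one_carrier_free_algebra: "1 \<in> carrier (free_algebra G)"
  using scalar_carrier_free_algebra[of 1] by (simp add: scalar_def)

lemma zero_carrier_free_algebra: "0 \<in> carrier (free_algebra G)"
  by (simp add: carrier_free_algebra)

lemma gen_carrier_free_algebra: "g \<in> G \<Longrightarrow> gen g \<in> carrier (free_algebra G)"
  by (simp add: carrier_free_algebra gen_def)

lemma power_carrier_free_algebra:
  "f \<in> carrier (free_algebra G) \<Longrightarrow> f ^ k \<in> carrier (free_algebra G)"
  by (induction k) (simp_all add: one_carrier_free_algebra mult_carrier_free_algebra)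

lemma sum_carrier_free_algebra:
  "(\<And>i. i \<in> A \<Longrightarrow> h i \<in> carrier (free_algebra G)) \<Longrightarrow> sum h A \<in> carrier (free_algebra G)"
  by (induction A rule: infinite_finite_induct)
    (simp_all add: zero_carrier_free_algebra add_carrier_free_algebra)

lemmas carrier_free_algebra_intros =
  add_carrier_free_algebra diff_carrier_free_algebra mult_carrier_free_algebra
  scalar_carrier_free_algebra one_carrier_free_algebra gen_carrier_free_algebra
  power_carrier_free_algebra sum_carrier_free_algebra

lemma free_algebra_sel:
  "x \<otimes>\<^bsub>free_algebra G\<^esub> y = x * y" "\<one>\<^bsub>free_algebra G\<^esub> = 1"
  "\<zero>\<^bsub>free_algebra G\<^esub> = 0" "x \<oplus>\<^bsub>free_algebra G\<^esub> y = x + y"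
  by (simp_all add: free_algebra_def)

lemma ring_free_algebra: "ring (free_algebra G :: ('g free_mon \<Rightarrow>\<^sub>0 'k::field) ring)"
proof (rule ringI)
  show "abelian_group (free_algebra G :: ('g free_mon \<Rightarrow>\<^sub>0 'k) ring)"
    by (rule abelian_groupI)
      (auto simp: free_algebra_sel add_carrier_free_algebra zero_carrier_free_algebra add.assoc
        add.commute intro!: bexI[OF _ uminus_carrier_free_algebra])
  show "Group.monoid (free_algebra G :: ('g free_mon \<Rightarrow>\<^sub>0 'k) ring)"
    by (rule monoidI)
      (auto simp: free_algebra_sel mult_carrier_free_algebra one_carrier_free_algebra mult.assoc)
qed (simp_all add: free_algebra_sel algebra_simps)

end


section \<open>The action of the free algebra on coordinate vectors\<close>

definition coord_vecs :: "nat \<Rightarrow> (nat \<Rightarrow> 'k::zero) set" where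
  "coord_vecs m = {v. \<forall>l. l \<notin> {1..m} \<longrightarrow> v l = 0}"

context
  fixes m a b :: nat and q p :: "'k::field"
begin

abbreviation "act_word \<equiv> foldr (act_gen m q p a b)"
abbreviation "act \<equiv> act_free m q p a b"

section \<open>Linearity and multiplicativity of the action\<close>

lemma act_word_add: "act_word ws (\<lambda>l. v l + w l) = (\<lambda>l. act_word ws v l + act_word ws w l)"
  by (induction ws) (simp_all add: act_gen_def algebra_simps sum.distrib)

lemma act_word_smult: "act_word ws (\<lambda>l. c * v l) = (\<lambda>l. c * act_word ws v l)"
  by (induction ws) (simp_all add: act_gen_def sum_distrib_left mult.assoc)

lemma act_zero: "act 0 v = (\<lambda>l. 0)"
  by (simp add: act_free_def)

lemma act_single: "act (Poly_Mapping.single w c) v = (\<lambda>l. c * act_word (letters w) v l)"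
  by (simp add: act_free_def)

lemma act_add: "act (f + g) v = (\<lambda>l. act f v l + act g v l)"
proof
  fix l
  \<comment> \<open>Cancellation can make the support of \<open>f + g\<close> smaller than the union
    of the supports, so all three sums are extended by zero coefficients to this common index
    set.\<close>
  let ?K = "Poly_Mapping.keys f \<union> Poly_Mapping.keys g"
  have ext: "act h v l = (\<Sum>w\<in>?K. Poly_Mapping.lookup h w * act_word (letters w) v l)"
    if "Poly_Mapping.keys h \<subseteq> ?K" for h
    unfolding act_free_def
    by (rule sum.mono_neutral_left) (use that in \<open>auto simp: in_keys_iff\<close>)
  show "act (f + g) v l = act f v l + act g v l"
    using keys_add[of f g]
    by (simp add: ext lookup_add algebra_simps sum.distrib)
qed

lemma act_uminus: "act (- f) v = (\<lambda>l. - act f v l)"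
proof
  fix l
  have "act (f + (- f)) v l = 0"
    by (simp add: act_zero)
  then show "act (- f) v l = - act f v l"
    by (simp only: act_add) (simp add: eq_neg_iff_add_eq_0 add.commute)
qed

lemma act_diff: "act (f - g) v = (\<lambda>l. act f v l - act g v l)"
  using act_add[of f "- g" v] by (simp add: act_uminus)

lemma act_vec_add: "act f (\<lambda>l. v l + w l) = (\<lambda>l. act f v l + act f w l)"
  by (induction f rule: poly_mapping_single_add_induct)
    (simp_all add: act_zero act_single act_add act_word_add algebra_simps)

lemma act_vec_smult: "act f (\<lambda>l. c * v l) = (\<lambda>l. c * act f v l)"
  by (induction f rule: poly_mapping_single_add_induct)
    (simp_all add: act_zero act_single act_add act_word_smult algebra_simps)

lemma act_vec_zero: "act f (\<lambda>l. 0) = (\<lambda>l. 0)"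
  using act_vec_smult[of f 0] by simp

text \<open>Both sides are additive in \<open>f\<close> and in \<open>g\<close>, which leaves
  monomials. There the product concatenates words, \<open>foldr\<close> turns concatenation into
  composition, and the coefficient of the right factor moves past the left word by
  linearity.\<close>

lemma act_mult: "act (f * g) v = act f (act g v)"
proof (induction f rule: poly_mapping_single_add_induct)
  case zero
  show ?case by (simp add: act_zero)
next
  case (single w c)
  show ?case
    by (induction g rule: poly_mapping_single_add_induct)
      (simp_all add: act_zero act_vec_zero act_add act_vec_add act_single mult_single
        plus_free_mon_def act_word_smult distrib_left mult.assoc)
next
  case (add f1 f2)
  then show ?case by (simp add: act_add distrib_right)
qed

lemma act_scalar: "act (scalar c) v = (\<lambda>l. c * v l)"
  by (simp add: scalar_def act_single zero_free_mon_def)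

lemma act_one: "act 1 v = v"
  using act_scalar[of 1] by (simp add: scalar_def)

lemma act_gen_eq: "act (gen g) v = act_gen m q p a b g v"
  by (simp add: gen_def act_single)

lemma act_sum: "act (sum h A) v = (\<lambda>l. \<Sum>i\<in>A. act (h i) v l)"
  by (induction A rule: infinite_finite_induct) (simp_all add: act_zero act_add)

lemma act_power_diag:
  assumes "\<And>v. v \<in> coord_vecs m \<Longrightarrow> act f v = (\<lambda>l. d l * v l)" and "v \<in> coord_vecs m"
  shows "act (f ^ k) v = (\<lambda>l. d l ^ k * v l)"
proof (induction k)
  case 0
  show ?case by (simp add: act_one)
next
  case (Suc k)
  have "(\<lambda>l. d l ^ k * v l) \<in> coord_vecs m"
    using assms(2) by (simp add: coord_vecs_def)
  then show ?case
    by (simp add: act_mult Suc assms(1) mult.assoc)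
qed

section \<open>Coordinate formulas for the generators\<close>

definition x_eigenvalue :: "nat \<Rightarrow> nat \<Rightarrow> 'k" where
  "x_eigenvalue i l = (if l = i then q ^ a else q ^ b)"

lemma act_x:
  assumes "v \<in> coord_vecs m"
  shows "act (xx i) v = (\<lambda>l. x_eigenvalue i l * v l)"
proof
  fix l
  have "act (xx i) v l = (\<Sum>j = 1..m. if j = l then x_eigenvalue i l * v l else 0)"
    unfolding act_gen_eq act_gen_def
    by (rule sum.cong) (auto simp: basis_vec_def x_eigenvalue_def)
  then show "act (xx i) v l = x_eigenvalue i l * v l"
    using assms by (auto simp: coord_vecs_def)
qed

text \<open>The rule for basis vectors, read on coordinates: since z_k sends u_k to q^(ab) u_{k+1},
  the factor appears at the target coordinate \<open>k + 1\<close>, which receives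
  \<open>v k\<close>.\<close>

definition z_op :: "nat \<Rightarrow> (nat \<Rightarrow> 'k) \<Rightarrow> nat \<Rightarrow> 'k" where
  "z_op k v l = (if l = k then v (k + 1)
    else if l = k + 1 then q ^ (a * b) * v k else p ^ (b ^ 2) * v l)"

lemma act_z:
  assumes "v \<in> coord_vecs m" "k \<in> {1..<m}"
  shows "act (zz k) v = z_op k v"
proof
  fix l
  \<comment> \<open>Up to scalars z_k permutes the basis by the transposition of \<open>k\<close>
    and \<open>k + 1\<close>, so a single summand reaches coordinate \<open>l\<close>.\<close>
  have "act (zz k) v l = (\<Sum>j = 1..m. if j = transpose k (k + 1) l then z_op k v l else 0)"
    unfolding act_gen_eq act_gen_def
    by (rule sum.cong) (auto simp: basis_vec_def transpose_def z_op_def)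
  then show "act (zz k) v l = z_op k v l"
    using assms by (auto simp: coord_vecs_def transpose_def z_op_def)
qed

lemma z_op_coord_vecs:
  "v \<in> coord_vecs m \<Longrightarrow> k \<in> {1..<m} \<Longrightarrow> z_op k v \<in> coord_vecs m"
  by (simp add: coord_vecs_def z_op_def)

lemma act_coord_vecs_gen:
  assumes "g \<in> H_gens m" "v \<in> coord_vecs m"
  shows "act_gen m q p a b g v \<in> coord_vecs m"
proof (cases g)
  case (GX i)
  then show ?thesis
    using assms act_x[OF assms(2), of i] by (simp add: act_gen_eq coord_vecs_def)
next
  case (GZ k)
  then have "k \<in> {1..<m}"
    using assms(1) by (auto simp: H_gens_def)
  with GZ show ?thesis
    using assms(2) act_z[OF assms(2), of k] z_op_coord_vecs[of v k] by (simp add: act_gen_eq)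
qed

lemma act_coord_vecs:
  assumes "f \<in> carrier (free_algebra (H_gens m))" "v \<in> coord_vecs m"
  shows "act f v \<in> coord_vecs m"
proof -
  have "act_word ws v \<in> coord_vecs m" if "set ws \<subseteq> H_gens m" for ws
    using that by (induction ws) (simp_all add: assms(2) act_coord_vecs_gen)
  then have "act_word (letters w) v l = 0" if "w \<in> Poly_Mapping.keys f" "l \<notin> {1..m}" for w l
    using assms(1) that by (force simp: carrier_free_algebra coord_vecs_def)
  then show ?thesis
    by (simp add: coord_vecs_def act_free_def)
qed

text \<open>The additive group of \<open>V_module\<close> with the free algebra acting instead of
  its quotient; it is the input \<open>M\<close> of \<open>left_module_Quot\<close>.\<close>

definition free_V_module :: "(generator free_mon \<Rightarrow>\<^sub>0 'k, nat \<Rightarrow> 'k) module" where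
  "free_V_module =
    \<lparr>carrier = coord_vecs m, monoid.mult = undefined, one = undefined,
     zero = (\<lambda>_. 0), add = (\<lambda>v w l. v l + w l), smult = act\<rparr>"

lemma left_module_free_V_module: "left_module (free_algebra (H_gens m)) free_V_module"
proof (intro left_module.intro left_module_axioms.intro ring_free_algebra)
  have "\<exists>w \<in> coord_vecs m. (\<lambda>l. w l + v l) = (\<lambda>_. 0)" if "v \<in> coord_vecs m" for v :: "nat \<Rightarrow> 'k"
    using that by (intro bexI[of _ "\<lambda>l. - v l"]) (auto simp: coord_vecs_def)
  then show "abelian_group free_V_module"
    by (intro abelian_groupI) (auto simp: free_V_module_def coord_vecs_def add.assoc add.commute)
qed (auto simp: free_V_module_def free_algebra_sel act_coord_vecs act_add act_vec_add act_mult act_one)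

end


section \<open>The defining relations\<close>

lemma primitive_root_power_inj:
  fixes q :: "'k::field"
  assumes "primitive_root n q" "i < n" "j < n" "q ^ i = q ^ j"
  shows "i = j"
  using assms(2-4)
proof (induction i j rule: linorder_wlog)
  case (le i j)
  have "q \<noteq> 0"
    using assms(1) by (auto simp: primitive_root_def zero_power)
  then have "q ^ (j - i) = 1"
    using le by (simp add: power_diff)
  then show ?case
    using assms(1) le unfolding primitive_root_def
    by (metis diff_is_0_eq' le_antisym less_imp_diff_less zero_less_diff not_le)
qed simp

text \<open>Orthogonality of the characters of Z/n: the summands are the powers of r = q^e / q^i, an
  n-th root of unity that equals 1 only if i = e, so otherwise the geometric sum vanishes.\<close>

lemma primitive_root_sum:
  fixes q :: "'k::field"
  assumes q: "primitive_root n q" and "i < n" "e < n"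
  shows "(\<Sum>j = 0..n - 1. q powi - (int i * int j) * (q ^ e) ^ j) = (if i = e then of_nat n else 0)"
proof -
  have n: "n > 0" "q ^ n = 1"
    using q by (auto simp: primitive_root_def)
  then have q0: "q \<noteq> 0"
    by (auto simp: zero_power)
  define r where "r = q ^ e / q ^ i"
  have "q powi - (int i * int j) * (q ^ e) ^ j = r ^ j" for j
    unfolding r_def
    by (simp add: power_int_minus divide_inverse power_mult_distrib power_inverse mult.commute
      flip: of_nat_mult power_mult)
  \<comment> \<open>Subtraction is truncated, so this depends on \<open>n > 0\<close>.\<close>
  moreover have "{0..n - 1} = {..<n}"
    using n by auto
  ultimately have "(\<Sum>j = 0..n - 1. q powi - (int i * int j) * (q ^ e) ^ j) = (\<Sum>j<n. r ^ j)"
    by simp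
  also have "\<dots> = (if i = e then of_nat n else 0)"
  proof (cases "i = e")
    case True
    then show ?thesis using q0 by (simp add: r_def)
  next
    case False
    then have "r \<noteq> 1"
      using primitive_root_power_inj[OF q assms(2,3)] q0 by (auto simp: r_def)
    moreover have "r ^ n = 1"
      by (simp add: r_def power_divide mult.commute[of _ n] flip: power_mult)
        (simp add: power_mult n q0)
    ultimately show ?thesis
      using False by (simp add: geometric_sum)
  qed
  finally show ?thesis .
qed

text \<open>The right side of the relation for z_k^2, evaluated on a joint eigenvector on which x_k
  and x_{k+1} have eigenvalues q^c and q^e. Orthogonality in \<open>j\<close> leaves only
  \<open>i = e\<close>, and the resulting factor \<open>n\<close> is invertible in characteristic
  zero.\<close>

lemma primitive_root_double_sum:
  fixes q :: "'k::field_char_0"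
  assumes q: "primitive_root n q" and "c < n" "e < n"
  shows "1 / of_nat n * (\<Sum>i = 0..n - 1. \<Sum>j = 0..n - 1.
    q powi - (int i * int j) * (q ^ c) ^ i * (q ^ e) ^ j) = q ^ (c * e)"
proof -
  have n: "n > 0"
    using q by (simp add: primitive_root_def)
  have "(\<Sum>i = 0..n - 1. \<Sum>j = 0..n - 1. q powi - (int i * int j) * (q ^ c) ^ i * (q ^ e) ^ j) =
      (\<Sum>i = 0..n - 1. (q ^ c) ^ i * (\<Sum>j = 0..n - 1. q powi - (int i * int j) * (q ^ e) ^ j))"
    by (simp add: sum_distrib_left mult_ac)
  also have "\<dots> = (\<Sum>i = 0..n - 1. if i = e then (q ^ c) ^ e * of_nat n else 0)"
    using n by (intro sum.cong refl, subst primitive_root_sum[OF q _ assms(3)]) auto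
  also have "\<dots> = (q ^ c) ^ e * of_nat n"
    using assms(3) by auto
  finally show ?thesis
    using n by (simp add: power_mult)
qed

section \<open>The relations and the ideal they generate act as zero\<close>

lemma GX_mem_H_gens: "GX i \<in> H_gens m \<longleftrightarrow> i \<in> {1..m}"
  and GZ_mem_H_gens: "GZ k \<in> H_gens m \<longleftrightarrow> k \<in> {1..<m}"
  by (auto simp: H_gens_def)

lemma transpose_Suc_mem:
  "k \<in> {1..<m} \<Longrightarrow> i \<in> {1..m} \<Longrightarrow> transpose k (k + 1) i \<in> {1..m}" for k m i :: nat
  by (auto simp: transpose_def)

lemma H_rels_carrier: "H_rels n m q \<subseteq> carrier (free_algebra (H_gens m))"
  unfolding H_rels_def
  by (auto intro!: carrier_free_algebra_intros
    simp: GX_mem_H_gens GZ_mem_H_gens transpose_Suc_mem[simplified])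

text \<open>The x_i are diagonal and the z_k are transpositions with scalar factors, so most
  relations are comparisons of coordinates. For the last one, z_k^2 is also diagonal, and its
  entries are the values of the double sum.\<close>

lemma act_H_rels:
  fixes q p :: "'k::field_char_0"
  assumes q: "primitive_root n q" and p: "p ^ 2 = q" and ab: "a < n" "b < n"
    and r: "r \<in> H_rels n m q" and v: "v \<in> coord_vecs m"
  shows "act_free m q p a b r v = (\<lambda>_. 0)"
proof -
  let ?act = "act_free m q p a b" and ?d = "x_eigenvalue a b q"
  have qn: "q ^ n = 1"
    using q by (simp add: primitive_root_def)
  have X: "?act (xx i) w = (\<lambda>l. ?d i l * w l)" if "w \<in> coord_vecs m" for i w
    using that by (rule act_x)
  have Xv: "(\<lambda>l. ?d i l * w l) \<in> coord_vecs m" if "w \<in> coord_vecs m" for i w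
    using that by (simp add: coord_vecs_def)
  have Xpow: "?act (xx i ^ k) w = (\<lambda>l. ?d i l ^ k * w l)" if "w \<in> coord_vecs m" for i k w
    using X that by (rule act_power_diag)
  have Z: "?act (zz k) w = z_op a b q p k w" if "w \<in> coord_vecs m" "k \<in> {1..<m}" for k w
    using that by (rule act_z)
  have Zv: "z_op a b q p k w \<in> coord_vecs m" if "w \<in> coord_vecs m" "k \<in> {1..<m}" for k w
    using that by (rule z_op_coord_vecs)
  have dn: "?d i l ^ n = 1" for i l
    by (simp add: x_eigenvalue_def mult.commute[of _ n] flip: power_mult)
      (simp add: power_mult qn)
  show ?thesis
    using r unfolding H_rels_def Un_iff mem_Collect_eq
  proof (elim disjE exE conjE)
    fix i assume "r = xx i ^ n - 1"
    then show ?thesis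
      using v by (simp add: act_diff act_one Xpow dn)
  next
    fix i j assume "r = xx i * xx j - xx j * xx i"
    then show ?thesis
      using v by (simp add: act_diff act_mult X Xv mult.left_commute)
  next
    \<comment> \<open>The eigenvalue of x_{s_k(i)} on u_l is that of x_i on u_{s_k(l)}, and z_k
      exchanges these two lines.\<close>
    fix k i assume "r = zz k * xx i - xx (transpose k (k + 1) i) * zz k" "k \<in> {1..<m}"
    then show ?thesis
      using v
      by (simp add: act_diff act_mult X Xv Z Zv) (auto simp: z_op_def x_eigenvalue_def transpose_def)
  next
    fix k l assume "r = zz k * zz l - zz l * zz k"
      and "k \<in> {1..<m}" "l \<in> {1..<m}" "\<bar>int k - int l\<bar> > 1"
    then show ?thesis
      using v by (simp add: act_diff act_mult Z Zv) (rule ext, auto simp: z_op_def)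
  next
    \<comment> \<open>On u_k, u_{k+1}, u_{k+2} both sides reverse the order of the three lines, with
      the same factors p^(b^2) q^(2ab), p^(b^2) q^(ab) and p^(b^2).\<close>
    fix k assume "r = zz k * zz (k + 1) * zz k - zz (k + 1) * zz k * zz (k + 1)"
      and "k \<in> {1..<m}" "k + 1 \<in> {1..<m}"
    then show ?thesis
      using v by (simp add: act_diff act_mult Z Zv) (rule ext, auto simp: z_op_def)
  next
    fix k assume z2: "r = zz k ^ 2 - scalar (1 / of_nat n) * (\<Sum>i = 0..n - 1. \<Sum>j = 0..n - 1.
        scalar (q powi - (int i * int j)) * xx k ^ i * xx (k + 1) ^ j)" "k \<in> {1..<m}"
    have "?act r v l = 0" for l
    proof -
      \<comment> \<open>The scalar by which the right side of the relation acts on coordinate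
        \<open>l\<close>.\<close>
      define S where "S = 1 / of_nat n * (\<Sum>i = 0..n - 1. \<Sum>j = 0..n - 1.
        q powi - (int i * int j) * ?d k l ^ i * ?d (k + 1) l ^ j)"
      \<comment> \<open>Here the square root \<open>p\<close> of \<open>q\<close> enters: off
        \<open>k\<close> and \<open>k + 1\<close>, applying z_k twice multiplies by p^(b^2) twice,
        that is, by q^(b^2).\<close>
      have pp: "p ^ e * (p ^ e * x) = q ^ e * x" for e x
        by (simp add: p[symmetric] power2_eq_square power_mult_distrib)
      have "?act (zz k ^ 2) v l = (if l = k \<or> l = k + 1 then q ^ (a * b) else q ^ (b * b)) * v l"
        unfolding power2_eq_square[of "zz k"] act_mult Z[OF v z2(2)] Z[OF Zv[OF v z2(2)] z2(2)]
        by (simp add: z_op_def pp power2_eq_square)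
      also have "(if l = k \<or> l = k + 1 then q ^ (a * b) else q ^ (b * b)) = S"
      proof -
        \<comment> \<open>On u_l the eigenvalues of x_k and x_{k+1} are (q^a, q^b), (q^b, q^a) and
          (q^b, q^b) in the three cases.\<close>
        consider "l = k" | "l = k + 1" | "l \<noteq> k" "l \<noteq> k + 1"
          by blast
        then show ?thesis
        proof cases
          case 1
          then show ?thesis
            using primitive_root_double_sum[OF q ab] by (simp add: S_def x_eigenvalue_def)
        next
          case 2
          then show ?thesis
            using primitive_root_double_sum[OF q ab(2,1)]
            by (simp add: S_def x_eigenvalue_def mult.commute[of b a])
        next
          case 3
          then show ?thesis
            using primitive_root_double_sum[OF q ab(2,2)] by (simp add: S_def x_eigenvalue_def)
        qed
      qed
      also have "S * v l = ?act (scalar (1 / of_nat n) * (\<Sum>i = 0..n - 1. \<Sum>j = 0..n - 1.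
          scalar (q powi - (int i * int j)) * xx k ^ i * xx (k + 1) ^ j)) v l"
      proof -
        have "(\<lambda>l. ?d (k + 1) l ^ j * v l) \<in> coord_vecs m" for j
          using v by (simp add: coord_vecs_def)
        then show ?thesis
          unfolding S_def act_mult act_scalar act_sum Xpow[OF v]
          by (simp only: Xpow mult.assoc sum_distrib_right)
      qed
      finally show ?thesis
        by (simp only: z2(1) act_diff diff_self)
    qed
    then show ?thesis by blast
  qed
qed

text \<open>Vanishing passes from the relations to the whole generated ideal through the annihilator
  of the coordinate space. The quotient construction then gives the module axioms and the action of
  a coset by its representative.\<close>

lemma V_module_action:
  fixes m :: nat and q p :: "'k::field_char_0"
  assumes q: "primitive_root n q" and p: "p ^ 2 = q" and ab: "a < n" "b < n"
  defines "F \<equiv> free_algebra (H_gens m) :: (generator free_mon \<Rightarrow>\<^sub>0 'k) ring"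
  shows "left_module (H_algebra n m q) (V_module m q p a b)"
    and "\<And>f v. \<lbrakk>f \<in> carrier F; v \<in> coord_vecs m\<rbrakk> \<Longrightarrow>
      smult (V_module m q p a b) (Idl\<^bsub>F\<^esub> H_rels n m q +>\<^bsub>F\<^esub> f) v = act_free m q p a b f v"
proof -
  let ?act = "act_free m q p a b" and ?I = "Idl\<^bsub>F\<^esub> H_rels n m q"
    and ?M = "free_V_module m a b q p"
  interpret F: ring F
    unfolding F_def by (rule ring_free_algebra)
  \<comment> \<open>The annihilator is a two-sided ideal: for products \<open>f * g\<close> with
    \<open>g\<close> arbitrary, it matters that \<open>g\<close> maps coordinate vectors to
    coordinate vectors.\<close>
  define J where "J = {f \<in> carrier F. \<forall>v \<in> coord_vecs m. ?act f v = (\<lambda>_. 0)}"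
  have "ideal J F"
  proof (rule idealI)
    show "subgroup J (add_monoid F)"
    proof (rule group.subgroupI)
      show "group (add_monoid F)"
        by (rule F.a_group)
      show "J \<noteq> {}"
        using F.zero_closed by (auto simp: J_def F_def free_algebra_sel act_zero)
      fix f assume f: "f \<in> J"
      have "\<ominus>\<^bsub>F\<^esub> f = - f"
        using f by (intro F.minus_equality)
          (auto simp: J_def F_def free_algebra_sel uminus_carrier_free_algebra)
      then have "inv\<^bsub>add_monoid F\<^esub> f = - f"
        by (simp only: a_inv_def)
      with f show "inv\<^bsub>add_monoid F\<^esub> f \<in> J"
        by (simp only:) (simp add: J_def F_def act_uminus uminus_carrier_free_algebra)
    qed (auto simp: J_def F_def free_algebra_sel act_add add_carrier_free_algebra)
  qed (auto simp: J_def F_def free_algebra_sel act_mult act_vec_zero act_coord_vecs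
    mult_carrier_free_algebra F.ring_axioms[unfolded F_def])
  moreover have "H_rels n m q \<subseteq> J"
    using act_H_rels[OF q p ab] H_rels_carrier unfolding J_def F_def by blast
  ultimately have "?I \<subseteq> J"
    by (rule F.genideal_minimal)
  then have ann: "r \<odot>\<^bsub>?M\<^esub> v = \<zero>\<^bsub>?M\<^esub>" if "r \<in> ?I" "v \<in> carrier ?M" for r v
    using that by (auto simp: J_def free_V_module_def)
  have "ideal ?I F"
    using H_rels_carrier unfolding F_def by (intro ring.genideal_ideal ring_free_algebra)
  note * = left_module_Quot[OF left_module_free_V_module[of m a b q p, folded F_def] this ann,
      where N = "V_module m q p a b"]
  show "left_module (H_algebra n m q) (V_module m q p a b)"
    unfolding H_algebra_def F_def[symmetric]
    by (rule *) (auto simp: V_module_def free_V_module_def coord_vecs_def)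
  show "smult (V_module m q p a b) (?I +>\<^bsub>F\<^esub> f) v = ?act f v"
    if "f \<in> carrier F" "v \<in> coord_vecs m" for f v
    using *(2)[of f v] that by (simp add: V_module_def free_V_module_def coord_vecs_def)
qed


section \<open>Simplicity\<close>

lemma coord_vec_eq_sum: "v \<in> coord_vecs m \<Longrightarrow> v = (\<lambda>l. \<Sum>j = 1..m. v j * basis_vec j l)"
  for v :: "nat \<Rightarrow> 'k::field"
  by (rule ext) (auto simp: coord_vecs_def basis_vec_def if_distrib cong: if_cong)

text \<open>The linear algebra behind simplicity, stated for the free algebra so that no cosets
  occur. Closure under scalars is covered by \<open>inv\<close>, since constants belong to the free
  algebra.\<close>

lemma invariant_subspace_trivial:
  fixes q p :: "'k::field"
  assumes q: "q \<noteq> 0" "q ^ a \<noteq> q ^ b"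
    and N: "N \<subseteq> coord_vecs m" "(\<lambda>_. 0) \<in> N" "\<And>v w. v \<in> N \<Longrightarrow> w \<in> N \<Longrightarrow> (\<lambda>l. v l + w l) \<in> N"
    and inv: "\<And>f v. f \<in> carrier (free_algebra (H_gens m)) \<Longrightarrow> v \<in> N \<Longrightarrow> act_free m q p a b f v \<in> N"
  shows "N = {\<lambda>_. 0} \<or> N = coord_vecs m"
proof (cases "N \<subseteq> {\<lambda>_. 0}")
  case True
  then show ?thesis using N(2) by blast
next
  case False
  let ?act = "act_free m q p a b"
  have scale: "(\<lambda>l. c * v l) \<in> N" if "v \<in> N" for c v
    using inv[OF scalar_carrier_free_algebra that] by (simp add: act_scalar)
  have unscale: "v \<in> N" if "(\<lambda>l. c * v l) \<in> N" "c \<noteq> 0" for c v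
    using scale[OF that(1), of "1 / c"] that(2) by simp
  have u: "basis_vec j \<in> coord_vecs m" if "j \<in> {1..m}" for j
    using that by (auto simp: basis_vec_def coord_vecs_def)
  obtain v i where vi: "v \<in> N" "v i \<noteq> 0"
    using False by force
  then have v: "v \<in> coord_vecs m" and i: "i \<in> {1..m}"
    using N(1) by (auto simp: coord_vecs_def)
  have "?act (xx i - scalar (q ^ b)) v \<in> N"
    using vi(1) i by (intro inv carrier_free_algebra_intros) (simp add: GX_mem_H_gens)
  also have "?act (xx i - scalar (q ^ b)) v = (\<lambda>l. ((q ^ a - q ^ b) * v i) * basis_vec i l)"
    by (rule ext)
      (simp add: act_diff act_x[OF v] act_scalar x_eigenvalue_def basis_vec_def left_diff_distrib)
  finally have ui: "basis_vec i \<in> N"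
    by (rule unscale) (use q(2) vi(2) in simp)
  have z: "?act (zz k) w \<in> N" if "k \<in> {1..<m}" "w \<in> N" for k w
    using that by (intro inv carrier_free_algebra_intros) (simp_all add: GZ_mem_H_gens)
  \<comment> \<open>The generators z_k link neighbouring basis vectors in both directions; going up
    costs the nonzero factor q^(ab), going down costs none.\<close>
  have up: "basis_vec (Suc k) \<in> N" if k: "k \<in> {1..<m}" and uk: "basis_vec k \<in> N" for k
  proof (rule unscale)
    have "?act (zz k) (basis_vec k) = (\<lambda>l. q ^ (a * b) * basis_vec (Suc k) l)"
      using k by (subst act_z[OF u k]) (auto simp: z_op_def basis_vec_def)
    then show "(\<lambda>l. q ^ (a * b) * basis_vec (Suc k) l) \<in> N"
      using z[OF k uk] by simp
  qed (use q(1) in simp)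
  have down: "basis_vec k \<in> N" if k: "k \<in> {1..<m}" and uk: "basis_vec (Suc k) \<in> N" for k
  proof -
    have "?act (zz k) (basis_vec (Suc k)) = basis_vec k"
      using k by (subst act_z[OF u k]) (auto simp: z_op_def basis_vec_def)
    then show ?thesis
      using z[OF k uk] by simp
  qed
  have uN: "basis_vec j \<in> N" if j: "j \<in> {1..m}" for j
  proof (cases "i \<le> j")
    case True
    \<comment> \<open>Keeping the range bound as a premise inside the induction claim ensures that
      each step uses an existing generator z_k; the same holds for the lower bound on the way
      down.\<close>
    then have "j \<le> m \<longrightarrow> basis_vec j \<in> N"
      by (induction j rule: dec_induct) (use ui up i in auto)
    then show ?thesis using j by simp
  next
    case False
    then have "j \<le> i" by simp
    then have "j \<ge> 1 \<longrightarrow> basis_vec j \<in> N"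
      by (induction j rule: inc_induct) (use ui down i in auto)
    then show ?thesis using j by simp
  qed
  have "w \<in> N" if w: "w \<in> coord_vecs m" for w
  proof -
    \<comment> \<open>\<open>N\<close> is closed under binary sums, so the basis expansion is built
      up over finite index sets.\<close>
    have "(\<lambda>l. \<Sum>j\<in>A. w j * basis_vec j l) \<in> N" if "finite A" "A \<subseteq> {1..m}" for A
      using that by (induction A) (auto simp: N(2) intro!: N(3) scale uN)
    from this[of "{1..m}"] show ?thesis
      by (subst coord_vec_eq_sum[OF w]) simp
  qed
  then show ?thesis
    using N(1) by blast
qed

theorem lemma15:
  fixes n m a b :: nat and q p :: "'k::field_char_0"
  assumes "n \<ge> 2" and "m \<ge> 2"
    and "primitive_root n q" and "p ^ 2 = q"
    and "a < n" and "b < n"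
    and "\<not> [a = b] (mod n)"
  shows "simple_left_module (H_algebra n m q) (V_module m q p a b)"
proof -
  let ?V = "V_module m q p a b" and ?F = "free_algebra (H_gens m) :: (generator free_mon \<Rightarrow>\<^sub>0 'k) ring"
  note V = V_module_action[where m = m, OF assms(3-6)]
  interpret left_module "H_algebra n m q" ?V
    by (rule V(1))
  have sel: "carrier ?V = coord_vecs m" "\<zero>\<^bsub>?V\<^esub> = (\<lambda>_. 0)" "v \<oplus>\<^bsub>?V\<^esub> w = (\<lambda>l. v l + w l)" for v w
    by (simp_all add: V_module_def coord_vecs_def)
  show ?thesis
  proof (intro simple_left_module.intro V(1) simple_left_module_axioms.intro)
    have "basis_vec 1 \<in> coord_vecs m" "basis_vec 1 \<noteq> (\<lambda>_. 0 :: 'k)"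
      using assms(2) by (auto simp: basis_vec_def coord_vecs_def fun_eq_iff)
    then show "carrier ?V \<noteq> {\<zero>\<^bsub>?V\<^esub>}"
      unfolding sel by blast
  next
    fix N assume "submodule N (H_algebra n m q) ?V"
    then interpret N: submodule N "H_algebra n m q" ?V .
    have "q \<noteq> 0"
      using assms(3) by (auto simp: primitive_root_def zero_power)
    \<comment> \<open>This is where incongruence enters: equal powers with exponents below
      \<open>n\<close> would force \<open>a = b\<close>.\<close>
    moreover have "q ^ a \<noteq> q ^ b"
      using primitive_root_power_inj[OF assms(3) assms(5,6)] assms(7) by auto
    moreover have "N \<subseteq> coord_vecs m"
      using N.subset by (simp add: sel)
    \<comment> \<open>A submodule is a subgroup of the additive monoid, so \<open>one_closed\<close>
      concerns the zero vector and \<open>m_closed\<close> the sum.\<close>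
    moreover have "(\<lambda>_. 0) \<in> N"
      using N.one_closed by (simp add: sel)
    moreover have "(\<lambda>l. v l + w l) \<in> N" if "v \<in> N" "w \<in> N" for v w
      using N.m_closed[OF that] by (simp add: sel)
    moreover have "act_free m q p a b f v \<in> N" if f: "f \<in> carrier ?F" and v: "v \<in> N" for f v
    proof -
      \<comment> \<open>Every free algebra element acts on \<open>N\<close> as its coset does, so
        invariance under the quotient gives invariance under the free algebra.\<close>
      have "Idl\<^bsub>?F\<^esub> H_rels n m q +>\<^bsub>?F\<^esub> f \<in> carrier (H_algebra n m q)"
        using f by (auto simp: H_algebra_def FactRing_def A_RCOSETS_def')
      from N.smult_closed[OF this v] show ?thesis
        using V(2)[OF f] v \<open>N \<subseteq> coord_vecs m\<close> by auto
    qed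
    ultimately have "N = {\<lambda>_. 0} \<or> N = coord_vecs m"
      by (rule invariant_subspace_trivial)
    then show "N = {\<zero>\<^bsub>?V\<^esub>} \<or> N = carrier ?V"
      by (simp add: sel)
  qed
qed

end
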